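(* Let $(V,\omega)$ be a symplectic real vector space of dimension $2n$ with a fixed basis. If $[\omega]^2=-I_{2n}$, then $$Sp_{\omega}(n;\mathbb{R})=\left\{B\in GL(2n): B[\omega]B^T=B^T[\omega]B=[\omega]\right\}.$$
   Context: A symplectic vector space $(V,\omega)$ is a finite-dimensional real vector space $V$ (of even dimension $2n$) with an alternating non-degenerate bilinear form $\omega:V\times V\to\mathbb{R}$. A (not necessarily symplectic) basis of $V$ is fixed and $[\omega]\in\mathbb{M}_{2n}(\mathbb{R})$ is the (skew-symmetric, invertible) matrix of $\omega$ in this basis, so $\omega(\mathbf u,\mathbf v)=\mathbf u^T[\omega]\mathbf v$ in coordinates. $GL(2n)$ is the group of invertible real $2n\times 2n$ matrices, $I_{2n}$ is the identity matrix, and $Sp_{\omega}(n;\mathbb{R})=\{B\in GL(2n): B^T[\omega]B=[\omega]\}$ is the $\omega$-symplectic group. *)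

theory Defs
  imports "HOL-Analysis.Analysis"
begin

(* The finite spanning set is required separately because dim is 0 by convention on
   infinite-dimensional spaces. *)
definition symplectic_space :: "('v::real_vector \<Rightarrow> 'v \<Rightarrow> real) \<Rightarrow> nat \<Rightarrow> bool" where
  "symplectic_space \<omega> n \<longleftrightarrow>
     (\<exists>S::'v set. finite S \<and> span S = UNIV) \<and> dim (UNIV :: 'v set) = 2 * n \<and>
     bilinear \<omega> \<and> (\<forall>v. \<omega> v v = 0) \<and> (\<forall>u. (\<forall>v. \<omega> u v = 0) \<longrightarrow> u = 0)"

definition is_basis :: "('m::finite \<Rightarrow> 'v::real_vector) \<Rightarrow> bool" where
  "is_basis b \<longleftrightarrow> inj b \<and> independent (range b) \<and> span (range b) = UNIV"

definition form_matrix :: "('m::finite \<Rightarrow> 'v) \<Rightarrow> ('v \<Rightarrow> 'v \<Rightarrow> real) \<Rightarrow> real ^ 'm ^ 'm" where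
  "form_matrix b \<omega> = (\<chi> i j. \<omega> (b i) (b j))"

definition GL :: "(real ^ 'm ^ 'm) set" where
  "GL = {B. invertible B}"

definition Sp :: "('m::finite \<Rightarrow> 'v) \<Rightarrow> ('v \<Rightarrow> 'v \<Rightarrow> real) \<Rightarrow> (real ^ 'm ^ 'm) set" where
  "Sp b \<omega> = {B \<in> GL. transpose B ** form_matrix b \<omega> ** B = form_matrix b \<omega>}"

end

theory Submission
  imports Defs
begin

text \<open>Write \<open>W\<close> for the matrix of the form. If \<open>W\<^sup>2 = -1\<close> and \<open>B\<^sup>T W B = W\<close>, then
  \<open>-W B\<^sup>T W\<close> is a left inverse of \<open>B\<close>, hence also a right inverse; multiplying
  \<open>B W B\<^sup>T W = -1\<close> by \<open>W\<close> on the right gives \<open>B W B\<^sup>T = W\<close>.\<close>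

lemma matrix_mul_minus_left: "(- A) ** B = - (A ** B)"
  for A :: "'a::ring_1 ^ 'n ^ 'm" and B :: "'a ^ 'p ^ 'n"
  by (simp add: matrix_matrix_mult_def vec_eq_iff sum_negf)

lemma matrix_mul_minus_right: "A ** (- B) = - (A ** B)"
  for A :: "'a::ring_1 ^ 'n ^ 'm" and B :: "'a ^ 'p ^ 'n"
  by (simp add: matrix_matrix_mult_def vec_eq_iff sum_negf)

lemma congruence_transpose:
  fixes W B :: "'a::field ^ 'm ^ 'm"
  assumes W: "W ** W = - mat 1"
    and B: "transpose B ** W ** B = W"
  shows "B ** W ** transpose B = W"
proof -
  \<comment> \<open>Regrouped so that \<open>transpose B ** W ** B\<close> collapses to
    \<open>W\<close>, leaving \<open>- (W ** W)\<close>.\<close>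
  have "- (W ** transpose B ** W) ** B = - (W ** (transpose B ** W ** B))"
    by (simp add: matrix_mul_minus_left matrix_mul_assoc)
  also have "\<dots> = mat 1"
    by (simp add: B W)
  \<comment> \<open>For square matrices over a field, a one-sided inverse is two-sided.\<close>
  finally have "B ** - (W ** transpose B ** W) = mat 1"
    using matrix_left_right_inverse by blast
  then have "B ** W ** transpose B ** W = - mat 1"
    by (simp add: matrix_mul_minus_right matrix_mul_assoc minus_equation_iff[of _ "mat 1"])
  then have "(B ** W ** transpose B) ** (W ** W) = - W"
    by (simp add: matrix_mul_assoc matrix_mul_minus_left)
  \<comment> \<open>\<open>W ** W\<close> on the left contributes a factor -1, which cancels the
    sign on the right.\<close>
  then show ?thesis
    by (simp add: W matrix_mul_minus_right)
qed

theorem proposition3p2: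
  fixes n :: nat
    and \<omega> :: "'v::real_vector \<Rightarrow> 'v \<Rightarrow> real"
    and b :: "'m::finite \<Rightarrow> 'v"
  assumes "symplectic_space \<omega> n"
    and "CARD('m) = 2 * n"
    and "is_basis b"
    and "form_matrix b \<omega> ** form_matrix b \<omega> = - mat 1"
  shows "Sp b \<omega> =
    {B \<in> GL. B ** form_matrix b \<omega> ** transpose B = form_matrix b \<omega> \<and>
             transpose B ** form_matrix b \<omega> ** B = form_matrix b \<omega>}"
  \<comment> \<open>One inclusion drops a condition; the other gets it from the lemma with
    \<open>W\<close> the form matrix.\<close>
  unfolding Sp_def using congruence_transpose[OF assms(4)] by blast

end
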